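(* The set $\mathcal{P}$ of decimal palindromes is an additive basis for the natural numbers $\mathbb{N}=\{0,1,2,\ldots\}$. More precisely, every natural number is the sum of forty-nine (possibly zero) decimal palindromes.
   Context: Every $n\in\mathbb{N}$ has a unique decimal representation $n=\sum_{j=0}^{L-1}10^j\delta_j$ with digits $\delta_j\in\{0,1,\ldots,9\}$ and leading digit $\delta_{L-1}\neq 0$ whenever $L\ge 2$ (so $0$ has the single digit $0$, $L=1$). The number $n$ is a (decimal) palindrome if $\delta_j=\delta_{L-1-j}$ for all $0\le j<L$. $\mathcal{P}$ denotes the set of all palindromes in $\mathbb{N}$; in particular $0$ and every single digit are palindromes. *)

theory Defs
  imports Main
begin

text \<open>
  \<open>decimal_rep n L \<delta>\<close>: the digits \<open>\<delta> 0, \<dots>, \<delta> (L - 1)\<close> (least significant first) form the decimal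
  representation of \<open>n\<close>.  Values \<open>\<delta> j\<close> with \<open>j \<ge> L\<close> are irrelevant.  The condition \<open>1 \<le> L\<close> excludes
  the empty digit string, so that 0 has the single digit 0.
\<close>

definition decimal_rep :: "nat \<Rightarrow> nat \<Rightarrow> (nat \<Rightarrow> nat) \<Rightarrow> bool" where
  "decimal_rep n L \<delta> \<longleftrightarrow>
     1 \<le> L \<and> (\<forall>j<L. \<delta> j \<in> {0..9}) \<and> (2 \<le> L \<longrightarrow> \<delta> (L - 1) \<noteq> 0) \<and>
     n = (\<Sum>j<L. 10 ^ j * \<delta> j)"

lemma digit_sum_less:
  "\<forall>j<L. \<delta> j \<le> (9::nat) \<Longrightarrow> (\<Sum>j<L. 10 ^ j * \<delta> j) < 10 ^ L"
proof (induction L)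
  case (Suc L)
  have "10 ^ L * \<delta> L \<le> 10 ^ L * 9" using Suc.prems by (intro mult_left_mono) auto
  moreover have "(\<Sum>j<L. 10 ^ j * \<delta> j) < 10 ^ L" using Suc by auto
  ultimately show ?case unfolding sum.lessThan_Suc power_Suc by linarith
qed simp

lemma digit_sum_inj:
  "\<lbrakk>\<forall>j<L. \<delta> j \<le> (9::nat); \<forall>j<L. \<epsilon> j \<le> 9;
    (\<Sum>j<L. 10 ^ j * \<delta> j) = (\<Sum>j<L. 10 ^ j * \<epsilon> j); j < L\<rbrakk> \<Longrightarrow> \<delta> j = \<epsilon> j"
proof (induction L arbitrary: j)
  case (Suc L)
  let ?s = "\<lambda>\<delta>. \<Sum>j<L. 10 ^ j * \<delta> j :: nat"
  have l: "?s \<delta> < 10 ^ L" "?s \<epsilon> < 10 ^ L" using Suc.prems by (auto intro!: digit_sum_less)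
  have e: "?s \<delta> + 10 ^ L * \<delta> L = ?s \<epsilon> + 10 ^ L * \<epsilon> L" using Suc.prems(3) by simp
  have "(?s \<delta> + 10 ^ L * \<delta> L) div 10 ^ L = \<delta> L" "(?s \<epsilon> + 10 ^ L * \<epsilon> L) div 10 ^ L = \<epsilon> L"
    using l by simp_all
  then have top: "\<delta> L = \<epsilon> L" unfolding e by simp
  with e have s: "?s \<delta> = ?s \<epsilon>" by simp
  show ?case
  proof (cases "j = L")
    case False
    with Suc.prems(4) have "j < L" by simp
    with Suc.IH[OF _ _ s] Suc.prems(1,2) show ?thesis by simp
  qed (simp add: top)
qed simp

lemma decimal_rep_lower:
  assumes "decimal_rep n L \<delta>" "2 \<le> L"
  shows "10 ^ (L - 1) \<le> n"
proof -
  have "10 ^ (L - 1) * 1 \<le> 10 ^ (L - 1) * \<delta> (L - 1)"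
    using assms by (intro mult_left_mono) (auto simp: decimal_rep_def)
  also have "\<dots> \<le> (\<Sum>j<L. 10 ^ j * \<delta> j)"
    using assms(2) by (intro member_le_sum) auto
  finally show ?thesis using assms by (simp add: decimal_rep_def)
qed

lemma decimal_rep_length_le:
  assumes "decimal_rep n L \<delta>" "decimal_rep n M \<epsilon>"
  shows "L \<le> M"
proof (rule ccontr)
  assume "\<not> L \<le> M"
  moreover have "1 \<le> M" using assms by (simp add: decimal_rep_def)
  ultimately have "2 \<le> L" "M \<le> L - 1" by auto
  have "n < 10 ^ M" using assms(2) digit_sum_less[of M \<epsilon>] by (simp add: decimal_rep_def)
  also have "\<dots> \<le> 10 ^ (L - 1)" using \<open>M \<le> L - 1\<close> by (intro power_increasing) auto
  also have "\<dots> \<le> n" using decimal_rep_lower[OF assms(1) \<open>2 \<le> L\<close>] .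
  finally show False by simp
qed

lemma decimal_rep_unique:
  assumes "decimal_rep n L \<delta>" "decimal_rep n M \<epsilon>"
  shows "L = M" and "j < L \<Longrightarrow> \<delta> j = \<epsilon> j"
proof -
  show LM: "L = M" using assms decimal_rep_length_le by (meson le_antisym)
  show "\<delta> j = \<epsilon> j" if "j < L"
  proof (rule digit_sum_inj[of M \<delta> \<epsilon>])
    show "\<forall>j<M. \<delta> j \<le> 9" "\<forall>j<M. \<epsilon> j \<le> 9" "j < M"
      using assms that unfolding LM decimal_rep_def by simp_all
    show "(\<Sum>j<M. 10 ^ j * \<delta> j) = (\<Sum>j<M. 10 ^ j * \<epsilon> j)"
      using assms unfolding LM decimal_rep_def by metis
  qed
qed

lemma decimal_rep_exists: "\<exists>L \<delta>. decimal_rep n L \<delta>"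
proof (induction n rule: less_induct)
  case (less n)
  show ?case
  proof (cases "n < 10")
    case True
    then have "decimal_rep n 1 (\<lambda>_. n)" by (auto simp: decimal_rep_def)
    then show ?thesis by blast
  next
    case False
    then obtain L \<delta> where r: "decimal_rep (n div 10) L \<delta>" using less[of "n div 10"] by auto
    define \<epsilon> where "\<epsilon> = case_nat (n mod 10) \<delta>"
    have \<delta>0: "\<delta> (L - 1) \<noteq> 0" if "L = 1" using r False that by (auto simp: decimal_rep_def)
    have "(\<Sum>j<Suc L. 10 ^ j * \<epsilon> j) = n mod 10 + 10 * (\<Sum>j<L. 10 ^ j * \<delta> j)"
      by (subst sum.lessThan_Suc_shift) (simp add: \<epsilon>_def sum_distrib_left mult.assoc)
    also have "(\<Sum>j<L. 10 ^ j * \<delta> j) = n div 10" using r by (simp add: decimal_rep_def)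
    also have "n mod 10 + 10 * (n div 10) = n" by simp
    finally have "n = (\<Sum>j<Suc L. 10 ^ j * \<epsilon> j)" by simp
    moreover have "\<forall>j<Suc L. \<epsilon> j \<in> {0..9}"
      using r by (auto simp: decimal_rep_def \<epsilon>_def less_Suc_eq_le split: nat.split)
    moreover have L: "1 \<le> L" and d: "2 \<le> L \<Longrightarrow> \<delta> (L - 1) \<noteq> 0"
      using r unfolding decimal_rep_def by blast+
    have "\<delta> (L - 1) \<noteq> 0" using L d \<delta>0 by (cases "L = 1") simp_all
    moreover have "\<epsilon> (Suc L - 1) = \<delta> (L - 1)" using L by (cases L) (simp_all add: \<epsilon>_def)
    ultimately have "decimal_rep n (Suc L) \<epsilon>"
      unfolding decimal_rep_def by (metis One_nat_def Suc_le_mono le0)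
    then show ?thesis by blast
  qed
qed

definition palindrome :: "nat \<Rightarrow> bool" where
  "palindrome n \<longleftrightarrow> (\<exists>L \<delta>. decimal_rep n L \<delta> \<and> (\<forall>j<L. \<delta> j = \<delta> (L - 1 - j)))"

definition palindromes :: "nat set" where
  "palindromes = {n. palindrome n}"

lemma single_digit_palindrome: "n \<le> 9 \<Longrightarrow> n \<in> palindromes"
  unfolding palindromes_def palindrome_def mem_Collect_eq
  by (rule exI[of _ 1], rule exI[of _ "\<lambda>_. n"]) (auto simp: decimal_rep_def)

text \<open>Summands may be repeated.\<close>

definition additive_basis_of_order :: "nat \<Rightarrow> nat set \<Rightarrow> bool" where
  "additive_basis_of_order h A \<longleftrightarrow>
     (\<forall>n. \<exists>a :: nat \<Rightarrow> nat. (\<forall>i<h. a i \<in> A) \<and> n = (\<Sum>i<h. a i))"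

definition additive_basis :: "nat set \<Rightarrow> bool" where
  "additive_basis A \<longleftrightarrow> (\<exists>h. additive_basis_of_order h A)"

end

theory Submission
  imports Defs
begin

text \<open>
  Add three palindromes of length \<open>2h + 1\<close>, whose digits sum to \<open>a j\<close> at the positions \<open>j\<close> and
  \<open>2h - j\<close>, and two of length \<open>2h\<close>, whose digits sum to \<open>b j\<close> at the positions \<open>j\<close> and
  \<open>2h - 1 - j\<close>.  Position \<open>2h - (j + 1)\<close> then carries \<open>a (j + 1) + b j\<close> and position \<open>j < h\<close> carries
  \<open>a j + b j\<close>.  Working from both ends inwards, the low end of the target prescribes \<open>b j\<close> modulo 10,
  and the high end then prescribes \<open>a (j + 1)\<close>; with five palindromes the admissible ranges of the
  \<open>a j\<close> and \<open>b j\<close> are wide enough for this never to get stuck, and the middle coefficient absorbs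
  the carry of the lower half.  This reaches every number in \<open>[6 \<cdot> 100^h, 17 \<cdot> 100^h)\<close>; multiples of
  \<open>10^(2h + 1) + 1\<close> bring all of \<open>[6 \<cdot> 100^h, 600 \<cdot> 100^h)\<close> into that range.
\<close>

section \<open>Sums of a prescribed number of palindromes\<close>

definition palindrome_sum :: "nat \<Rightarrow> nat \<Rightarrow> bool" where
  "palindrome_sum k n \<longleftrightarrow> (\<exists>xs. length xs = k \<and> set xs \<subseteq> palindromes \<and> sum_list xs = n)"

lemma palindrome_sum_0: "palindrome_sum k 0"
  unfolding palindrome_sum_def
  by (rule exI[of _ "replicate k 0"]) (auto simp: sum_list_replicate intro: single_digit_palindrome)

lemma palindrome_sum_1: "n \<in> palindromes \<Longrightarrow> palindrome_sum 1 n"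
  unfolding palindrome_sum_def by (rule exI[of _ "[n]"]) auto

lemma palindrome_sum_add:
  assumes "palindrome_sum k m" "palindrome_sum l n"
  shows "palindrome_sum (k + l) (m + n)"
proof -
  obtain xs ys where "length xs = k" "set xs \<subseteq> palindromes" "sum_list xs = m"
    "length ys = l" "set ys \<subseteq> palindromes" "sum_list ys = n"
    using assms unfolding palindrome_sum_def by blast
  then show ?thesis
    unfolding palindrome_sum_def by (intro exI[of _ "xs @ ys"]) auto
qed

lemma palindrome_sum_mono:
  assumes "palindrome_sum k n" "k \<le> l"
  shows "palindrome_sum l n"
  using palindrome_sum_add[OF assms(1) palindrome_sum_0[of "l - k"]] assms(2) by simp

lemma palindrome_sum_imp_family:
  assumes "palindrome_sum k n"
  shows "\<exists>p. (\<forall>i<k. p i \<in> palindromes) \<and> n = (\<Sum>i<k. p i)"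
proof -
  obtain xs where "length xs = k" "set xs \<subseteq> palindromes" "sum_list xs = n"
    using assms unfolding palindrome_sum_def by blast
  then show ?thesis
    by (intro exI[of _ "\<lambda>i. xs ! i"]) (auto simp: sum_list_sum_nth atLeast0LessThan)
qed

section \<open>Symmetric coefficient sequences as sums of palindromes\<close>

lemma symmetric_digits_palindrome:
  assumes "1 \<le> L" "\<And>j. j < L \<Longrightarrow> c j \<le> 9" "\<And>j. j < L \<Longrightarrow> c (L - 1 - j) = c j" "1 \<le> c 0"
  shows "(\<Sum>j<L. c j * 10 ^ j) \<in> palindromes"
proof -
  have "c (L - 1) \<noteq> 0" using assms(1,4) assms(3)[of 0] by simp
  then have "decimal_rep (\<Sum>j<L. c j * 10 ^ j) L c"
    using assms(1,2) unfolding decimal_rep_def by (auto simp: mult.commute)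
  then show ?thesis
    using assms(3) unfolding palindromes_def palindrome_def
    by (intro CollectI exI[of _ L] exI[of _ c]) simp
qed

text \<open>Peel off the palindrome with digits \<open>c j div Suc k\<close>: it inherits the
  symmetry, and a leading coefficient of at least \<open>Suc k\<close> makes its end digits nonzero
  while leaving at least \<open>k\<close> for the other summands.\<close>

lemma palindrome_sum_symmetric:
  assumes "1 \<le> L" "\<And>j. j < L \<Longrightarrow> c j \<le> 9 * k" "\<And>j. j < L \<Longrightarrow> c (L - 1 - j) = c j" "k \<le> c 0"
  shows "palindrome_sum k (\<Sum>j<L. c j * 10 ^ j)"
  using assms
proof (induction k arbitrary: c)
  case 0
  then have "(\<Sum>j<L. c j * 10 ^ j) = 0" by simp
  then show ?case by (simp only: palindrome_sum_0)
next
  case (Suc k)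
  define d where "d j = c j div Suc k" for j
  have dc: "d j \<le> c j" for j unfolding d_def by simp
  have le: "d j \<le> 9" "c j - d j \<le> 9 * k" if "j < L" for j
  proof -
    have c: "c j = d j * Suc k + c j mod Suc k" unfolding d_def by (rule div_mult_mod_eq[symmetric])
    have "d j \<le> (9 * Suc k) div Suc k"
      unfolding d_def using Suc.prems(2)[OF that] by (rule div_le_mono)
    then show d: "d j \<le> 9" by (simp only: nonzero_mult_div_cancel_right)
    show "c j - d j \<le> 9 * k"
    \<comment> \<open>If \<open>d j\<close> is at most 8, the rest
      \<open>d j * k + c j mod Suc k\<close> is at most \<open>8 * k + k\<close>; for the digit 9
      the bound on \<open>c j\<close> itself is enough.\<close>
    proof (cases "d j = 9")
      case True
      then show ?thesis using Suc.prems(2)[OF that] by simp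
    next
      case False
      then have "d j * k \<le> 8 * k" using d by (intro mult_le_mono1) simp
      moreover have "c j mod Suc k \<le> k" by (simp add: less_Suc_eq_le[symmetric])
      ultimately show ?thesis using c unfolding mult_Suc_right by linarith
    qed
  qed
  have "Suc k div Suc k \<le> d 0"
    unfolding d_def using Suc.prems(4) by (rule div_le_mono)
  then have d0: "1 \<le> d 0" by simp
  have sym: "d (L - 1 - j) = d j" if "j < L" for j
    unfolding d_def using Suc.prems(3)[OF that] by simp
  have "d 0 * Suc k \<le> c 0" unfolding d_def by (rule div_times_less_eq_dividend)
  moreover have "1 * k \<le> d 0 * k" using d0 by (rule mult_le_mono1)
  ultimately have "k \<le> c 0 - d 0" unfolding mult_Suc_right by linarith
  then have "palindrome_sum k (\<Sum>j<L. (c j - d j) * 10 ^ j)"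
    using Suc.prems(1,3) le sym by (intro Suc.IH) auto
  moreover have "(\<Sum>j<L. d j * 10 ^ j) \<in> palindromes"
    using Suc.prems(1) le sym d0 by (intro symmetric_digits_palindrome) auto
  ultimately have "palindrome_sum (k + 1) ((\<Sum>j<L. (c j - d j) * 10 ^ j) + (\<Sum>j<L. d j * 10 ^ j))"
    by (intro palindrome_sum_add palindrome_sum_1)
  also have "(\<Sum>j<L. (c j - d j) * 10 ^ j) + (\<Sum>j<L. d j * 10 ^ j) = (\<Sum>j<L. c j * 10 ^ j)"
    by (simp add: sum.distrib[symmetric] add_mult_distrib[symmetric] dc)
  finally show ?case by simp
qed

lemma sum_lessThan_add: "(\<Sum>j<m + n. f j) = (\<Sum>j<m. f j) + (\<Sum>j<n. f (m + j))"
  for f :: "nat \<Rightarrow> 'a::comm_monoid_add"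
  by (induction n) (simp_all add: add.assoc)

text \<open>The halves are kept apart because they are matched against different ends of the target;
  the upper one is indexed by the distance from the leading position.\<close>

lemma palindrome_sum_even:
  assumes "1 \<le> h" "\<And>j. j < h \<Longrightarrow> b j \<le> 9 * k" "k \<le> b 0"
  shows "palindrome_sum k ((\<Sum>j<h. b j * 10 ^ j) + 10 ^ h * (\<Sum>j<h. b j * 10 ^ (h - Suc j)))"
proof -
  define c where "c j = (if j < h then b j else b (h + h - 1 - j))" for j
  have "palindrome_sum k (\<Sum>j<h + h. c j * 10 ^ j)"
    using assms by (intro palindrome_sum_symmetric) (auto simp: c_def)
  also have "(\<Sum>j<h + h. c j * 10 ^ j) = (\<Sum>j<h. c j * 10 ^ j) + (\<Sum>j<h. c (h + j) * 10 ^ (h + j))"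
    by (rule sum_lessThan_add)
  also have "(\<Sum>j<h. c j * 10 ^ j) = (\<Sum>j<h. b j * 10 ^ j)" by (simp add: c_def)
  also have "(\<Sum>j<h. c (h + j) * 10 ^ (h + j)) = (\<Sum>j<h. c (h + (h - Suc j)) * 10 ^ (h + (h - Suc j)))"
    by (rule sum.nat_diff_reindex[symmetric])
  also have "\<dots> = (\<Sum>j<h. 10 ^ h * (b j * 10 ^ (h - Suc j)))"
    by (intro sum.cong) (auto simp: c_def power_add[symmetric])
  also have "\<dots> = 10 ^ h * (\<Sum>j<h. b j * 10 ^ (h - Suc j))" by (rule sum_distrib_left[symmetric])
  finally show ?thesis .
qed

lemma palindrome_sum_odd:
  assumes "1 \<le> h" "\<And>j. j < h \<Longrightarrow> a j \<le> 9 * k" "m \<le> 9 * k" "k \<le> a 0"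
  shows "palindrome_sum k ((\<Sum>j<h. a j * 10 ^ j) + 10 ^ h * (m + (\<Sum>j<h. a j * 10 ^ (h - j))))"
proof -
  define c where "c j = (if j < h then a j else if j = h then m else a (h + h - j))" for j
  have "palindrome_sum k (\<Sum>j<Suc h + h. c j * 10 ^ j)"
    using assms by (intro palindrome_sum_symmetric) (auto simp: c_def)
  also have "(\<Sum>j<Suc h + h. c j * 10 ^ j) =
      (\<Sum>j<Suc h. c j * 10 ^ j) + (\<Sum>j<h. c (Suc h + j) * 10 ^ (Suc h + j))"
    by (rule sum_lessThan_add)
  also have "(\<Sum>j<Suc h. c j * 10 ^ j) = (\<Sum>j<h. a j * 10 ^ j) + 10 ^ h * m" by (simp add: c_def)
  also have "(\<Sum>j<h. c (Suc h + j) * 10 ^ (Suc h + j)) =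
      (\<Sum>j<h. c (Suc h + (h - Suc j)) * 10 ^ (Suc h + (h - Suc j)))"
    by (rule sum.nat_diff_reindex[symmetric])
  also have "\<dots> = (\<Sum>j<h. 10 ^ h * (a j * 10 ^ (h - j)))"
    by (intro sum.cong) (auto simp: c_def Suc_diff_Suc power_add[symmetric])
  also have "\<dots> = 10 ^ h * (\<Sum>j<h. a j * 10 ^ (h - j))" by (rule sum_distrib_left[symmetric])
  finally show ?thesis by (simp add: distrib_left add.assoc)
qed

text \<open>For a nonzero digit \<open>d\<close>, the number \<open>d * (10 ^ m + 1)\<close> has the
  digits d, 0, ..., 0, d; \<open>D\<close> is split greedily into \<open>k\<close> digits.\<close>

lemma palindrome_sum_mult_power_plus_1:
  assumes "1 \<le> m" "D \<le> 9 * k"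
  shows "palindrome_sum k (D * (10 ^ m + 1))"
  using assms(2)
proof (induction k arbitrary: D)
  case 0
  then show ?case by (simp add: palindrome_sum_0)
next
  case (Suc k)
  define d where "d = min D 9"
  have "palindrome_sum 1 (d * (10 ^ m + 1))"
  proof (cases "d = 0")
    case True
    then show ?thesis by (simp only: mult_0 palindrome_sum_0)
  next
    case False
    define c where "c j = (if j = 0 \<or> j = m then d else 0)" for j
    have "palindrome_sum 1 (\<Sum>j<Suc m. c j * 10 ^ j)"
      using False assms(1) by (intro palindrome_sum_symmetric) (auto simp: c_def d_def)
    moreover have "(\<Sum>j<m. c j * 10 ^ j) = d"
      using assms(1) by (subst sum.remove[of _ 0]) (auto simp: c_def)
    then have "(\<Sum>j<Suc m. c j * 10 ^ j) = d * (10 ^ m + 1)" by (simp add: c_def)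
    ultimately show ?thesis by simp
  qed
  moreover have "palindrome_sum k ((D - d) * (10 ^ m + 1))"
    using Suc.prems by (intro Suc.IH) (simp add: d_def)
  ultimately have "palindrome_sum (1 + k) (d * (10 ^ m + 1) + (D - d) * (10 ^ m + 1))"
    by (rule palindrome_sum_add)
  also have "d * (10 ^ m + 1) + (D - d) * (10 ^ m + 1) = D * (10 ^ m + 1)"
    unfolding add_mult_distrib[symmetric] by (simp add: d_def)
  finally show ?case by simp
qed

section \<open>Five palindromes for one interval\<close>

text \<open>A window of ten values for \<open>b j\<close> meets every residue modulo 10; it starts
  at 2 so that two even-length palindromes get nonzero leading digits. The offset 11 then puts
  \<open>a (Suc j)\<close> between \<open>e (Suc j)\<close> and \<open>e (Suc j) + 9\<close>, and
  carries stay at most 3 because \<open>18 + 11 + 3 = 32\<close>.\<close>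

lemma coefficients_exist:
  fixes e l :: "nat \<Rightarrow> nat"
  assumes "e 0 \<le> 18" "\<And>j. e (Suc j) \<le> 9" "\<And>j. l j \<le> 9"
  obtains a c b :: "nat \<Rightarrow> nat" where "a 0 = e 0" "c 0 = 0"
    "\<And>j. a j \<le> 18" "\<And>j. 2 \<le> b j" "\<And>j. b j \<le> 11" "\<And>j. c j \<le> 3"
    "\<And>j. a j + b j + c j = l j + 10 * c (Suc j)" "\<And>j. a (Suc j) + b j = 11 + e (Suc j)"
proof -
  let ?P = "\<lambda>j (a, b, c). (j = 0 \<longrightarrow> a = e 0 \<and> c = 0) \<and> a \<le> 18 \<and> 2 \<le> b \<and> b \<le> 11 \<and> c \<le> 3 \<and>
    (a + b + c) mod 10 = l j"
  let ?Q = "\<lambda>j (a, b, c) (a', b' :: nat, c'). c' = (a + b + c) div 10 \<and> a' + b = 11 + e (Suc j)"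
  have b_exists: "\<exists>b. 2 \<le> b \<and> b \<le> 11 \<and> (x + b) mod 10 = l j" for x j
  proof -
    \<comment> \<open>Modulo 10, the 9 acts as -1 and the 8 as -2, so \<open>2 + y mod 10\<close> is
      congruent to \<open>l j - x\<close> without natural subtraction.\<close>
    define y where "y = l j + 9 * x + 8"
    have "(x + (2 + y mod 10)) mod 10 = (x + (2 + y)) mod 10"
      by (simp only: add.assoc[symmetric] mod_add_right_eq)
    also have "x + (2 + y) = l j + 10 * (x + 1)" by (simp add: y_def)
    also have "\<dots> mod 10 = l j" using assms(3)[of j] by (simp only: mod_mult_self2) simp
    finally show ?thesis by (intro exI[of _ "2 + y mod 10"]) simp
  qed
  have "\<exists>f. \<forall>j. ?P j (f j) \<and> ?Q j (f j) (f (Suc j))"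
  proof (rule dependent_nat_choice)
    show "\<exists>x. ?P 0 x" using assms(1) b_exists[of "e 0" 0] by auto
  next
    fix x j
    assume P: "?P j x"
    obtain a b c where x: "x = (a, b, c)" by (cases x)
    define a' where "a' = 11 + e (Suc j) - b"
    define c' where "c' = (a + b + c) div 10"
    obtain b' where "2 \<le> b'" "b' \<le> 11" "(a' + c' + b') mod 10 = l (Suc j)" using b_exists by blast
    moreover have "c' \<le> 3" "a' \<le> 18" "a' + b = 11 + e (Suc j)"
      using P assms(2)[of j] unfolding x a'_def c'_def by auto
    ultimately have "?P (Suc j) (a', b', c') \<and> ?Q j x (a', b', c')"
      unfolding x by (auto simp: c'_def add_ac)
    then show "\<exists>y. ?P (Suc j) y \<and> ?Q j x y" by blast
  qed
  then obtain f where "\<forall>j. ?P j (f j) \<and> ?Q j (f j) (f (Suc j))" by (rule exE)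
  note f = spec[OF this, THEN conjunct1] spec[OF this, THEN conjunct2]
  define a b c where "a j = fst (f j)" and "b j = fst (snd (f j))" and "c j = snd (snd (f j))" for j
  then have f_eq: "f j = (a j, b j, c j)" for j by simp
  have P: "?P j (a j, b j, c j)" and Q: "?Q j (a j, b j, c j) (a (Suc j), b (Suc j), c (Suc j))" for j
    using f(1)[of j] f(2)[of j] by (simp_all only: f_eq)
  show thesis
  proof (rule that[of a c b])
    show "a j + b j + c j = l j + 10 * c (Suc j)" for j
      using P[of j] Q[of j] mod_mult_div_eq[of "a j + b j + c j" 10] by simp
    show "a 0 = e 0" "c 0 = 0" using P[of 0] by simp_all
    show "a j \<le> 18" "2 \<le> b j" "b j \<le> 11" "c j \<le> 3" for j using P[of j] by simp_all
    show "a (Suc j) + b j = 11 + e (Suc j)" for j using Q[of j] by simp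
  qed
qed

lemma mod_power_10_Suc:
  "n mod 10 ^ Suc j = n mod 10 ^ j + n div 10 ^ j mod 10 * 10 ^ j" for n :: nat
  using mod_mult2_eq'[of n "10 ^ j" 10] by (simp add: mult.commute)

lemma palindrome_sum_5:
  assumes "1 \<le> h" "6 * 100 ^ h \<le> r" "r < 17 * 100 ^ h"
  shows "palindrome_sum 5 r"
proof -
  define W where "W = r div 10 ^ h"
  define R where "R = (\<Sum>j<h. 10 ^ (h - Suc j) :: nat)"
  \<comment> \<open>\<open>11 * R\<close> removes the offset 11 from every
    \<open>a (Suc j) + b j\<close>; the 9 is reserved for the middle coefficient.\<close>
  define V where "V = W - (11 * R + 9)"
  \<comment> \<open>The digits of \<open>V\<close> from the top. The first entry is not reduced
    modulo 10; it lies between 3 and 16, and the 3 gives three odd-length palindromes nonzero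
    leading digits.\<close>
  define e where "e j = (if j = 0 then V div 10 ^ h else V div 10 ^ (h - j) mod 10)" for j
  have sq: "(100::nat) ^ h = 10 ^ h * 10 ^ h" by (simp add: power_mult_distrib[symmetric])
  have h10: "(10::nat) \<le> 10 ^ h" using assms(1) power_increasing[of 1 h "10::nat"] by simp
  have "R = (\<Sum>j<h. 10 ^ j)" unfolding R_def by (rule sum.nat_diff_reindex)
  moreover have "9 * (\<Sum>j<k. 10 ^ j) + 1 = (10::nat) ^ k" for k by (induction k) auto
  ultimately have R: "9 * R + 1 = 10 ^ h" by simp
  have "(6 * 10 ^ h * 10 ^ h) div 10 ^ h \<le> W"
    unfolding W_def using assms(2) sq by (intro div_le_mono) (simp add: mult.assoc)
  then have W6: "6 * 10 ^ h \<le> W" by simp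
  have W17: "W < 17 * 10 ^ h"
    unfolding W_def using assms(3) sq by (simp add: less_mult_imp_div_less mult.assoc)
  have V: "V + (11 * R + 9) = W" and V3: "3 * 10 ^ h \<le> V"
    using W6 R h10 unfolding V_def by linarith+
  have "V < 17 * 10 ^ h" using V W17 by linarith
  then have "e 0 < 17" by (simp add: e_def less_mult_imp_div_less)
  then have e18: "e 0 \<le> 18" by simp
  have e3: "3 \<le> e 0" using div_le_mono[OF V3, of "10 ^ h"] by (simp add: e_def)
  have e9: "e (Suc j) \<le> 9" for j unfolding e_def by simp
  have l9: "r div 10 ^ j mod 10 \<le> 9" for j by simp
  obtain a c b where abc: "a 0 = e 0" "c 0 = 0"
    "\<And>j. a j \<le> 18" "\<And>j. 2 \<le> b j" "\<And>j. b j \<le> 11" "\<And>j. c j \<le> 3"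
    "\<And>j. a j + b j + c j = r div 10 ^ j mod 10 + 10 * c (Suc j)"
    "\<And>j. a (Suc j) + b j = 11 + e (Suc j)"
    by (fact coefficients_exist[of e "\<lambda>j. r div 10 ^ j mod 10", OF e18 e9 l9])
  \<comment> \<open>Here \<open>c m\<close> is the carry out of the lowest \<open>m\<close>
    positions.\<close>
  have low: "(\<Sum>j<m. a j * 10 ^ j) + (\<Sum>j<m. b j * 10 ^ j) = r mod 10 ^ m + c m * 10 ^ m" for m
  proof (induction m)
    case 0
    show ?case using abc(2) by simp
  next
    case (Suc m)
    have "(a m + b m + c m) * 10 ^ m = (r div 10 ^ m mod 10 + 10 * c (Suc m)) * 10 ^ m"
      using abc(7) by simp
    then show ?case using Suc.IH unfolding mod_power_10_Suc by (simp add: algebra_simps)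
  qed
  have e_sum: "(\<Sum>j\<le>m. e j * 10 ^ (m - j)) = V div 10 ^ (h - m)" if "m \<le> h" for m
    using that
  proof (induction m)
    case 0
    show ?case by (simp add: e_def)
  next
    case (Suc m)
    have "(\<Sum>j\<le>Suc m. e j * 10 ^ (Suc m - j)) = 10 * (\<Sum>j\<le>m. e j * 10 ^ (m - j)) + e (Suc m)"
      by (simp add: sum_distrib_left Suc_diff_le algebra_simps)
    also have "(\<Sum>j\<le>m. e j * 10 ^ (m - j)) = V div 10 ^ (h - m)" using Suc by simp
    also have "h - m = Suc (h - Suc m)" using Suc.prems by simp
    also have "V div 10 ^ Suc (h - Suc m) = V div 10 ^ (h - Suc m) div 10"
      by (simp only: power_Suc2 div_mult2_eq)
    finally show ?case by (simp add: e_def)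
  qed
  \<comment> \<open>\<open>a (Suc j)\<close> and \<open>b j\<close> share the weight
    \<open>10 ^ (h - Suc j)\<close>; \<open>a h\<close> completes the last pair.\<close>
  have "a h + (\<Sum>j<h. a j * 10 ^ (h - j)) + (\<Sum>j<h. b j * 10 ^ (h - Suc j)) =
      (\<Sum>j\<le>h. a j * 10 ^ (h - j)) + (\<Sum>j<h. b j * 10 ^ (h - Suc j))"
    by (simp add: lessThan_Suc_atMost[symmetric])
  also have "\<dots> = a 0 * 10 ^ h + (\<Sum>j<h. (a (Suc j) + b j) * 10 ^ (h - Suc j))"
    unfolding lessThan_Suc_atMost[symmetric] sum.lessThan_Suc_shift
    by (simp add: sum.distrib add_mult_distrib)
  also have "\<dots> = (e 0 * 10 ^ h + (\<Sum>j<h. e (Suc j) * 10 ^ (h - Suc j))) + 11 * R"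
    unfolding abc(1,8) R_def by (simp add: sum.distrib add_mult_distrib sum_distrib_left)
  also have "e 0 * 10 ^ h + (\<Sum>j<h. e (Suc j) * 10 ^ (h - Suc j)) = (\<Sum>j\<le>h. e j * 10 ^ (h - j))"
    unfolding lessThan_Suc_atMost[symmetric] sum.lessThan_Suc_shift by simp
  also have "\<dots> = V" using e_sum[of h] by simp
  finally have high: "a h + (\<Sum>j<h. a j * 10 ^ (h - j)) + (\<Sum>j<h. b j * 10 ^ (h - Suc j)) = V + 11 * R" .
  \<comment> \<open>Subtracting \<open>c h\<close> cancels the carry from below;
    \<open>c h \<le> 3\<close> and \<open>a h \<le> 18\<close> keep the value between 6 and
    27.\<close>
  let ?m = "a h + 9 - c h"
  have le: "?m \<le> 9 * 3" "a j \<le> 9 * 3" "b j \<le> 9 * 2" for j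
    using abc(3)[of h] abc(3)[of j] abc(5)[of j] by simp_all
  have "palindrome_sum (3 + 2)
    (((\<Sum>j<h. a j * 10 ^ j) + 10 ^ h * (?m + (\<Sum>j<h. a j * 10 ^ (h - j)))) +
     ((\<Sum>j<h. b j * 10 ^ j) + 10 ^ h * (\<Sum>j<h. b j * 10 ^ (h - Suc j))))"
    using assms(1) le abc(1,4) e3
    by (intro palindrome_sum_add palindrome_sum_odd palindrome_sum_even) simp_all
  also have "((\<Sum>j<h. a j * 10 ^ j) + 10 ^ h * (?m + (\<Sum>j<h. a j * 10 ^ (h - j)))) +
     ((\<Sum>j<h. b j * 10 ^ j) + 10 ^ h * (\<Sum>j<h. b j * 10 ^ (h - Suc j))) =
     ((\<Sum>j<h. a j * 10 ^ j) + (\<Sum>j<h. b j * 10 ^ j)) +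
     10 ^ h * (?m + (\<Sum>j<h. a j * 10 ^ (h - j)) + (\<Sum>j<h. b j * 10 ^ (h - Suc j)))"
    by (simp add: distrib_left)
  also have "\<dots> = r mod 10 ^ h + 10 ^ h *
     (c h + (?m + (\<Sum>j<h. a j * 10 ^ (h - j)) + (\<Sum>j<h. b j * 10 ^ (h - Suc j))))"
    unfolding low by (simp add: distrib_left)
  also have "c h + (?m + (\<Sum>j<h. a j * 10 ^ (h - j)) + (\<Sum>j<h. b j * 10 ^ (h - Suc j))) = W"
    using high V abc(6)[of h] by linarith
  also have "r mod 10 ^ h + 10 ^ h * W = r" unfolding W_def by simp
  finally show ?thesis by simp
qed

section \<open>Covering all natural numbers\<close>

text \<open>Remainders modulo \<open>q\<close> fill a window of length
  \<open>q \<le> 11 * 100 ^ h\<close> above \<open>6 * 100 ^ h\<close>, which five palindromes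
  cover. Since \<open>594 * 100 ^ h < 63 * q\<close>, the quotient is at most \<open>9 * 7\<close>,
  so seven more suffice.\<close>

lemma palindrome_sum_12:
  assumes "1 \<le> h" "6 * 100 ^ h \<le> n" "n < 600 * 100 ^ h"
  shows "palindrome_sum 12 n"
proof -
  define q :: nat where "q = 10 ^ (2 * h + 1) + 1"
  define D where "D = (n - 6 * 100 ^ h) div q"
  have q: "q = 10 * 100 ^ h + 1" by (simp add: q_def power_mult)
  have n: "n = D * q + (6 * 100 ^ h + (n - 6 * 100 ^ h) mod q)"
    using assms(2) unfolding D_def by simp
  have "n - 6 * 100 ^ h < 63 * q" using assms(3) q by linarith
  then have "D \<le> 9 * 7" by (simp add: D_def less_mult_imp_div_less less_imp_le)
  then have "palindrome_sum 7 (D * q)"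
    unfolding q_def by (intro palindrome_sum_mult_power_plus_1) simp_all
  moreover have "(n - 6 * 100 ^ h) mod q < q" using q by simp
  moreover have "(1::nat) < 100 ^ h" using assms(1) by (intro one_less_power) simp_all
  then have "6 * 100 ^ h + (n - 6 * 100 ^ h) mod q < 17 * 100 ^ h"
    using \<open>(n - 6 * 100 ^ h) mod q < q\<close> q by linarith
  then have "palindrome_sum 5 (6 * 100 ^ h + (n - 6 * 100 ^ h) mod q)"
    by (rule palindrome_sum_5[OF assms(1) le_add1])
  ultimately have "palindrome_sum (7 + 5) (D * q + (6 * 100 ^ h + (n - 6 * 100 ^ h) mod q))"
    by (intro palindrome_sum_add)
  then show ?thesis using n by simp
qed

text \<open>The palindromes 11, 22, ..., 99 handle \<open>n div 11 \<le> 54\<close>; the remainder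
  is split into two digits because it can be 10, which is no palindrome.\<close>

lemma palindrome_sum_12_less_600:
  assumes "n < 600"
  shows "palindrome_sum 12 n"
proof -
  have "palindrome_sum 7 (n div 11 * (10 ^ 1 + 1))"
    using assms by (intro palindrome_sum_mult_power_plus_1) auto
  moreover have "palindrome_sum (1 + 1) (n mod 11 div 2 + (n mod 11 - n mod 11 div 2))"
  proof (intro palindrome_sum_add palindrome_sum_1 single_digit_palindrome)
    have "n mod 11 < 11" by simp
    then show "n mod 11 div 2 \<le> 9" "n mod 11 - n mod 11 div 2 \<le> 9" by linarith+
  qed
  ultimately have "palindrome_sum (7 + (1 + 1))
      (n div 11 * (10 ^ 1 + 1) + (n mod 11 div 2 + (n mod 11 - n mod 11 div 2)))"
    by (rule palindrome_sum_add)
  then have "palindrome_sum 9 n" by simp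
  then show ?thesis by (rule palindrome_sum_mono) simp
qed

lemma palindrome_sum_12_all: "palindrome_sum 12 n"
proof -
  have "palindrome_sum 12 n" if "n < 600 * 100 ^ N" for N
    using that
  proof (induction N)
    case 0
    then show ?case by (simp add: palindrome_sum_12_less_600)
  next
    \<comment> \<open>Since \<open>600 * 100 ^ N = 6 * 100 ^ Suc N\<close>, the next interval starts
      where the induction hypothesis ends.\<close>
    case (Suc N)
    then show ?case
      using palindrome_sum_12[of "Suc N" n] by (cases "n < 600 * 100 ^ N") simp_all
  qed
  moreover have "n < 600 * 100 ^ n"
  proof -
    have "n < 100 ^ n" by (rule less_exp[THEN less_le_trans]) (simp add: power_mono)
    then show ?thesis by simp
  qed
  ultimately show ?thesis .
qed

theorem theorem1p1:
  shows "additive_basis palindromes \<and>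
    (\<forall>n::nat. \<exists>p :: nat \<Rightarrow> nat. (\<forall>i<49. p i \<in> palindromes) \<and> n = (\<Sum>i<49. p i))"
proof -
  \<comment> \<open>Twelve palindromes already suffice; zeros fill the places up to 49.\<close>
  have "\<exists>p. (\<forall>i<49. p i \<in> palindromes) \<and> n = (\<Sum>i<49::nat. p i)" for n
    by (rule palindrome_sum_imp_family[OF palindrome_sum_mono[OF palindrome_sum_12_all]]) simp
  then show ?thesis
    unfolding additive_basis_def additive_basis_of_order_def by blast
qed

end
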